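(* Let $B\in\mathbb{R}^{n\times n}$ be an irreducible non-negative matrix, let $\mathbf{x}_k>0$ with $\|\mathbf{x}_k\|=1$ not be an eigenvector of $B$, and let $\widehat{\lambda}_k=\max\left(\frac{B\mathbf{x}_k}{\mathbf{x}_k}\right)$. Let $\mathbf{y}_{k+1}$ be the solution of the Noda iteration system $(\widehat{\lambda}_kI-B)\mathbf{y}_{k+1}=\mathbf{x}_k$, and let $(\Delta\mathbf{y}_k,\delta_k)\in\mathbb{R}^n\times\mathbb{R}$ be a solution of the modified Noda iteration system $$\begin{pmatrix} B-\widehat{\lambda}_kI & -\mathbf{x}_k\\ -\mathbf{x}_k^T & 0\end{pmatrix}\begin{pmatrix}\Delta\mathbf{y}_k\\ \delta_k\end{pmatrix}=\begin{pmatrix}(\widehat{\lambda}_kI-B)\mathbf{x}_k\\ 0\end{pmatrix}.$$ Then the Noda iteration and the modified Noda iteration produce the same next vector: $$\frac{\mathbf{y}_{k+1}}{\|\mathbf{y}_{k+1}\|}=\frac{\mathbf{x}_k+\Delta\mathbf{y}_k}{\|\mathbf{x}_k+\Delta\mathbf{y}_k\|}.$$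
   Context: $\|\cdot\|$ is the 2-norm. For positive vectors $\mathbf{v}$ and vectors $\mathbf{w}$, $\max\left(\frac{\mathbf{w}}{\mathbf{v}}\right)=\max_i\mathbf{w}^{(i)}/\mathbf{v}^{(i)}$. A non-negative matrix is reducible if it can be brought to block upper-triangular form by a simultaneous row/column permutation, and irreducible otherwise. Both iterations update the eigenvalue approximation by $\widehat{\lambda}_{k+1}=\max\left(\frac{B\mathbf{x}_{k+1}}{\mathbf{x}_{k+1}}\right)$; the Noda iteration sets $\mathbf{x}_{k+1}=\mathbf{y}_{k+1}/\|\mathbf{y}_{k+1}\|$ and the modified Noda iteration sets $\mathbf{x}_{k+1}=(\mathbf{x}_k+\Delta\mathbf{y}_k)/\|\mathbf{x}_k+\Delta\mathbf{y}_k\|$. *)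

theory Defs
  imports "HOL-Analysis.Analysis"
begin

definition nonneg_matrix :: "real ^ 'n ^ 'n \<Rightarrow> bool" where
  "nonneg_matrix A \<longleftrightarrow> (\<forall>i j. 0 \<le> A $ i $ j)"

definition pos_vec :: "real ^ 'n \<Rightarrow> bool" where
  "pos_vec v \<longleftrightarrow> (\<forall>i. 0 < v $ i)"

(* The index type carries no order, so a simultaneous row/column permutation is
   an enumeration p of the indices by 0, ..., n - 1: the permuted matrix has
   entries A $ p i $ p j.  It is block upper-triangular, with square diagonal
   blocks of sizes r and n - r (both nonempty), if its lower-left block is 0. *)
definition reducible_matrix :: "real ^ 'n ^ 'n \<Rightarrow> bool" where
  "reducible_matrix A \<longleftrightarrow>
     (\<exists>p r. bij_betw p {..<CARD('n)} (UNIV :: 'n set) \<and> 0 < r \<and> r < CARD('n) \<and>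
        (\<forall>i \<in> {r..<CARD('n)}. \<forall>j \<in> {..<r}. A $ p i $ p j = 0))"

definition irreducible_matrix :: "real ^ 'n ^ 'n \<Rightarrow> bool" where
  "irreducible_matrix A \<longleftrightarrow> \<not> reducible_matrix A"

definition eigenvector_of :: "real ^ 'n ^ 'n \<Rightarrow> real ^ 'n \<Rightarrow> bool" where
  "eigenvector_of A v \<longleftrightarrow> v \<noteq> 0 \<and> (\<exists>\<mu>. A *v v = \<mu> *\<^sub>R v)"

definition max_ratio :: "real ^ 'n \<Rightarrow> real ^ 'n \<Rightarrow> real" where
  "max_ratio w v = Max (range (\<lambda>i. w $ i / v $ i))"

(* Bordered matrix (A, b; c\<^sup>T, d) and stacked vector (v; t) of size n + 1,
   with Inr () as the extra index. *)
definition bordered_matrix ::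
    "real ^ 'n ^ 'n \<Rightarrow> real ^ 'n \<Rightarrow> real ^ 'n \<Rightarrow> real \<Rightarrow> real ^ ('n + unit) ^ ('n + unit)" where
  "bordered_matrix A b c d =
     (\<chi> i j. case i of
        Inl k \<Rightarrow> (case j of Inl l \<Rightarrow> A $ k $ l | Inr _ \<Rightarrow> b $ k)
      | Inr _ \<Rightarrow> (case j of Inl l \<Rightarrow> c $ l | Inr _ \<Rightarrow> d))"

definition stacked_vector :: "real ^ 'n \<Rightarrow> real \<Rightarrow> real ^ ('n + unit)" where
  "stacked_vector v t = (\<chi> i. case i of Inl k \<Rightarrow> v $ k | Inr _ \<Rightarrow> t)"

(* In both systems, mat l is the scalar matrix l I. *)
definition noda_system :: "real ^ 'n ^ 'n \<Rightarrow> real \<Rightarrow> real ^ 'n \<Rightarrow> real ^ 'n \<Rightarrow> bool" where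
  "noda_system B l x y \<longleftrightarrow> (mat l - B) *v y = x"

definition modified_noda_system ::
    "real ^ 'n ^ 'n \<Rightarrow> real \<Rightarrow> real ^ 'n \<Rightarrow> real ^ 'n \<Rightarrow> real \<Rightarrow> bool" where
  "modified_noda_system B l x dy \<delta> \<longleftrightarrow>
     bordered_matrix (B - mat l) (- x) (- x) 0 *v stacked_vector dy \<delta> =
     stacked_vector ((mat l - B) *v x) 0"

end

theory Submission
  imports Defs
begin

text \<open>
  Write \<open>M = lam I - B\<close>.  The first block row of the modified system says that
  \<open>z = x + dy\<close> solves \<open>M z = - \<delta> x\<close>, and the last row says that \<open>dy\<close> is orthogonal to
  \<open>x\<close>, so that \<open>x \<bullet> z = x \<bullet> x > 0\<close>.  Since the Noda vector \<open>y\<close> solves \<open>M y = x\<close>, injectivity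
  of \<open>M\<close> gives \<open>z = - \<delta> y\<close>: both iterations move along the same line.  They agree after
  normalization exactly when \<open>- \<delta> > 0\<close>, and since \<open>- \<delta> (x \<bullet> y) = x \<bullet> z > 0\<close> it is enough
  that \<open>y\<close> is non-negative.

  Injectivity and \<open>y \<ge> 0\<close> both follow from the monotonicity of \<open>M\<close>: \<open>M v \<ge> 0\<close> implies
  \<open>v \<ge> 0\<close>.  This is the inverse positivity of a nonsingular M-matrix, proved here directly
  (lemma \<open>monotone_if_positive_supersolution\<close>).  The choice of \<open>lam\<close> makes \<open>M x \<ge> 0\<close>, and
  \<open>M x \<noteq> 0\<close> because \<open>x\<close> is not an eigenvector; so \<open>x\<close> is a positive strict supersolution
  against which any \<open>v\<close> can be compared, and irreducibility supplies a strong minimum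
  principle for the comparison (lemma \<open>irreducible_strong_minimum\<close>).
\<close>

lemma bordered_matrix_mult_stacked:
  fixes A :: "real ^ 'n ^ 'n"
  shows "bordered_matrix A b c d *v stacked_vector v t =
    stacked_vector (A *v v + t *\<^sub>R b) (c \<bullet> v + d * t)"
proof -
  have split: "(\<Sum>j\<in>UNIV. f j) = (\<Sum>l\<in>UNIV. f (Inl l)) + f (Inr ())"
    for f :: "'n + unit \<Rightarrow> real"
    by (simp flip: UNIV_Plus_UNIV add: sum.Plus UNIV_unit)
  show ?thesis
    by (simp add: vec_eq_iff bordered_matrix_def stacked_vector_def matrix_vector_mult_def
        inner_vec_def split split: sum.splits)
qed

lemma stacked_vector_eq_iff: "stacked_vector v s = stacked_vector w t \<longleftrightarrow> v = w \<and> s = t"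
proof
  assume "stacked_vector v s = stacked_vector w t"
  then have eq: "stacked_vector v s $ i = stacked_vector w t $ i" for i
    by simp
  show "v = w \<and> s = t"
    using eq[of "Inl _"] eq[of "Inr ()"] by (simp add: stacked_vector_def vec_eq_iff)
qed simp

lemma matrix_vector_mult_mat: "mat (l :: real) *v v = l *\<^sub>R v"
  by (simp add: vec_eq_iff matrix_vector_mult_def mat_def if_distrib[of "\<lambda>a. a * _"] cong: if_cong)

text \<open>
  Enumerating first the complement of \<open>Z\<close> and then \<open>Z\<close> itself puts the zero block of \<open>B\<close>
  into the lower left corner.
\<close>

lemma reducible_if_closed_set:
  fixes B :: "real ^ 'n ^ 'n"
  assumes ne: "Z \<noteq> {}" and proper: "Z \<noteq> UNIV"
    and closed: "\<And>i j. i \<in> Z \<Longrightarrow> j \<notin> Z \<Longrightarrow> B $ i $ j = 0"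
  shows "reducible_matrix B"
proof -
  define r where "r = card (- Z)"
  have card: "card Z + r = CARD('n)"
    unfolding r_def by (metis card_Un_disjoint finite Compl_disjoint Compl_partition)
  have "0 < r"
    using proper by (auto simp: r_def card_gt_0_iff)
  have "r < CARD('n)"
    using card ne by (simp add: card_gt_0_iff flip: card)
  obtain f where f: "bij_betw f {..<r} (- Z)"
    using finite_same_card_bij[of "{..<r}" "- Z"] by (auto simp: r_def)
  obtain g where g: "bij_betw g {r..<CARD('n)} Z"
  proof -
    have "card {r..<CARD('n)} = card Z"
      using card by simp
    then show ?thesis
      using finite_same_card_bij[of "{r..<CARD('n)}" Z] that by auto
  qed
  define p where "p = (\<lambda>k. if k \<in> {..<r} then f k else g k)"
  have "bij_betw p ({..<r} \<union> {r..<CARD('n)}) (- Z \<union> Z)"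
    unfolding p_def by (rule bij_betw_disjoint_Un[OF f g]) auto
  moreover have "{..<r} \<union> {r..<CARD('n)} = {..<CARD('n)}"
    using \<open>r < CARD('n)\<close> by auto
  ultimately have "bij_betw p {..<CARD('n)} UNIV"
    by simp
  moreover have "B $ p i $ p j = 0" if "i \<in> {r..<CARD('n)}" "j \<in> {..<r}" for i j
  proof (rule closed)
    show "p i \<in> Z" "p j \<notin> Z"
      using that bij_betwE[OF f] bij_betwE[OF g] by (auto simp: p_def)
  qed
  ultimately show ?thesis
    unfolding reducible_matrix_def using \<open>0 < r\<close> \<open>r < CARD('n)\<close> by blast
qed

text \<open>
  In a row \<open>i\<close> with \<open>w $ i = 0\<close>, the inequality bounds a sum of non-negative terms
  \<open>B $ i $ j * w $ j\<close> by zero, so every neighbour \<open>j\<close> of \<open>i\<close> is again a zero of \<open>w\<close>; by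
  irreducibility the zeros spread to all indices.
\<close>

lemma irreducible_strong_minimum:
  fixes B :: "real ^ 'n ^ 'n" and w :: "real ^ 'n"
  assumes nonneg: "nonneg_matrix B" and irred: "irreducible_matrix B"
    and w: "\<And>i. 0 \<le> w $ i" and super: "\<And>i. (B *v w) $ i \<le> l * w $ i"
    and zero: "w $ i\<^sub>0 = 0"
  shows "w = 0"
proof -
  define Z where "Z = {i. w $ i = 0}"
  have "B $ i $ j = 0" if i: "i \<in> Z" and j: "j \<notin> Z" for i j
  proof -
    have terms: "0 \<le> B $ i $ k * w $ k" for k
      using nonneg w by (simp add: nonneg_matrix_def)
    have "(\<Sum>k\<in>UNIV. B $ i $ k * w $ k) \<le> 0"
      using super[of i] i by (simp add: Z_def matrix_vector_mult_def)
    then have "(\<Sum>k\<in>UNIV. B $ i $ k * w $ k) = 0"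
      using terms by (intro antisym sum_nonneg) auto
    then have "B $ i $ j * w $ j = 0"
      using terms by (simp add: sum_nonneg_eq_0_iff)
    then show ?thesis
      using j by (simp add: Z_def)
  qed
  moreover have "Z \<noteq> {}"
    using zero by (auto simp: Z_def)
  ultimately have "Z = UNIV"
    using irred reducible_if_closed_set[of Z B] by (auto simp: irreducible_matrix_def)
  then show ?thesis
    by (auto simp: Z_def vec_eq_iff)
qed

text \<open>
  Subtract from \<open>v\<close> the largest multiple \<open>t x\<close> lying below it.  Were \<open>t < 0\<close>, the
  difference would be a supersolution touching zero, hence zero; but then \<open>v = t x\<close> and
  the inequalities for \<open>v\<close> and \<open>x\<close> have opposite signs, which forces \<open>x\<close> to be an eigenvector.
\<close>

lemma monotone_if_positive_supersolution:
  fixes B :: "real ^ 'n ^ 'n" and x v :: "real ^ 'n"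
  assumes nonneg: "nonneg_matrix B" and irred: "irreducible_matrix B"
    and pos: "pos_vec x" and not_eig: "B *v x \<noteq> l *\<^sub>R x"
    and x_super: "\<And>i. (B *v x) $ i \<le> l * x $ i"
    and v_super: "\<And>i. (B *v v) $ i \<le> l * v $ i"
  shows "0 \<le> v $ i"
proof -
  have x_pos: "0 < x $ i" for i
    using pos by (simp add: pos_vec_def)
  define t where "t = Min (range (\<lambda>i. v $ i / x $ i))"
  have below: "t * x $ i \<le> v $ i" for i
  proof -
    have "t \<le> v $ i / x $ i"
      unfolding t_def by (rule Min_le) auto
    then show ?thesis
      using x_pos[of i] by (simp add: field_simps)
  qed
  have "t \<in> range (\<lambda>i. v $ i / x $ i)"
    unfolding t_def by (rule Min_in) auto
  then obtain i\<^sub>0 where "t = v $ i\<^sub>0 / x $ i\<^sub>0"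
    by auto
  then have touch: "v $ i\<^sub>0 = t * x $ i\<^sub>0"
    using x_pos[of i\<^sub>0] by simp
  have "0 \<le> t"
  proof (rule ccontr)
    assume "\<not> 0 \<le> t"
    then have "t < 0" by simp
    define w where "w = v - t *\<^sub>R x"
    have Bw: "B *v w = B *v v - t *\<^sub>R (B *v x)"
      by (simp add: w_def matrix_vector_mult_diff_distrib matrix_vector_mult_scaleR)
    have "(B *v w) $ i \<le> l * w $ i" for i
    proof -
      have "t * (l * x $ i) \<le> t * (B *v x) $ i"
        using x_super[of i] \<open>t < 0\<close> by (intro mult_left_mono_neg) auto
      then show ?thesis
        using v_super[of i] unfolding Bw by (simp add: w_def algebra_simps)
    qed
    then have "w = 0"
      using below touch
      by (intro irreducible_strong_minimum[OF nonneg irred, of w l i\<^sub>0]) (auto simp: w_def)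
    then have v_eq: "v = t *\<^sub>R x"
      by (simp add: w_def)
    have "(B *v x) $ i = l * x $ i" for i
    proof (rule antisym[OF x_super])
      have "t * (B *v x) $ i \<le> t * (l * x $ i)"
        using v_super[of i] by (simp add: v_eq matrix_vector_mult_scaleR algebra_simps)
      then show "l * x $ i \<le> (B *v x) $ i"
        using \<open>t < 0\<close> by simp
    qed
    then show False
      using not_eig by (simp add: vec_eq_iff)
  qed
  then have "0 \<le> t * x $ i"
    using x_pos[of i] by simp
  then show ?thesis
    using below[of i] by linarith
qed

lemma mult_le_max_ratio:
  assumes "pos_vec x"
  shows "w $ i \<le> max_ratio w x * x $ i"
proof -
  have "w $ i / x $ i \<le> max_ratio w x"
    unfolding max_ratio_def by (rule Max_ge) auto
  then show ?thesis
    using assms by (simp add: pos_vec_def field_simps)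
qed

theorem mainTheorem6:
  fixes B :: "real ^ 'n ^ 'n"
    and x y dy :: "real ^ 'n"
    and lam \<delta> :: real
  assumes "nonneg_matrix B"
    and "irreducible_matrix B"
    and "pos_vec x"
    and "norm x = 1"
    and "\<not> eigenvector_of B x"
    and "lam = max_ratio (B *v x) x"
    and "noda_system B lam x y"
    and "modified_noda_system B lam x dy \<delta>"
  shows "y /\<^sub>R norm y = (x + dy) /\<^sub>R norm (x + dy)"
proof -
  define z where "z = x + dy"
  have x_nonneg: "0 \<le> x $ i" for i
    using \<open>pos_vec x\<close> by (simp add: pos_vec_def less_imp_le)
  have "x \<noteq> 0"
    using \<open>norm x = 1\<close> by auto
  have not_eig: "B *v x \<noteq> lam *\<^sub>R x"
    using \<open>\<not> eigenvector_of B x\<close> \<open>x \<noteq> 0\<close> by (auto simp: eigenvector_of_def)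
  have x_super: "(B *v x) $ i \<le> lam * x $ i" for i
    using mult_le_max_ratio[OF \<open>pos_vec x\<close>] \<open>lam = _\<close> by simp
  note monotone = monotone_if_positive_supersolution
    [OF \<open>nonneg_matrix B\<close> \<open>irreducible_matrix B\<close> \<open>pos_vec x\<close> not_eig x_super]

  have y: "lam *\<^sub>R y - B *v y = x"
    using \<open>noda_system B lam x y\<close>
    by (simp add: noda_system_def matrix_vector_mult_diff_rdistrib matrix_vector_mult_mat)
  have "(B - mat lam) *v dy - \<delta> *\<^sub>R x = (mat lam - B) *v x" and orth: "x \<bullet> dy = 0"
    using \<open>modified_noda_system B lam x dy \<delta>\<close>
    by (simp_all add: modified_noda_system_def bordered_matrix_mult_stacked stacked_vector_eq_iff)
  then have z: "lam *\<^sub>R z - B *v z = - \<delta> *\<^sub>R x"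
    by (simp add: z_def matrix_vector_mult_diff_rdistrib matrix_vector_mult_mat
        matrix_vector_right_distrib algebra_simps)

  \<comment> \<open>Injectivity: the difference of the two solutions and its negative are both non-negative.\<close>
  define u where "u = z + \<delta> *\<^sub>R y"
  have "lam *\<^sub>R u - B *v u = (lam *\<^sub>R z - B *v z) + \<delta> *\<^sub>R (lam *\<^sub>R y - B *v y)"
    by (simp add: u_def matrix_vector_right_distrib matrix_vector_mult_scaleR algebra_simps)
  then have Bu: "B *v u = lam *\<^sub>R u"
    unfolding y z by simp
  moreover have "B *v (- u) = lam *\<^sub>R (- u)"
    using Bu matrix_vector_mult_scaleR[of B "-1" u] by simp
  ultimately have "0 \<le> u $ i" "0 \<le> (- u) $ i" for i
    by (simp_all only: monotone vector_scaleR_component real_scaleR_def order.refl)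
  then have "u = 0"
    by (simp add: vec_eq_iff order.antisym)
  then have z_eq: "z = (- \<delta>) *\<^sub>R y"
    by (simp add: u_def eq_neg_iff_add_eq_0)

  have "(B *v y) $ i \<le> lam * y $ i" for i
    using arg_cong[OF y, of "\<lambda>v. v $ i"] x_nonneg[of i] by simp
  then have "0 \<le> y $ i" for i
    by (rule monotone)
  then have "0 \<le> x \<bullet> y"
    using x_nonneg by (auto simp: inner_vec_def intro!: sum_nonneg)
  moreover have "- \<delta> * (x \<bullet> y) = 1"
  proof -
    have "- \<delta> * (x \<bullet> y) = x \<bullet> z"
      by (simp add: z_eq)
    also have "\<dots> = 1"
      using orth \<open>norm x = 1\<close> by (simp add: z_def inner_add_right norm_eq_1)
    finally show ?thesis .
  qed
  ultimately have "0 < - \<delta>"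
    by (metis mult_nonpos_nonneg not_less zero_less_one)
  then have "z /\<^sub>R norm z = y /\<^sub>R norm y"
    by (simp add: z_eq)
  then show ?thesis
    by (simp add: z_def)
qed

end
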